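(* For all $n\geq 0$, as rational functions in $q$, \[ \sum_{\pi\in\operatorname{Inv}(n)} \left(\frac{1+q}{1-q}\right)^{\alpha_1(\pi)} = \sum_{\lambda\vdash n} f^\lambda\prod_{x\in\lambda} \frac{1+q^{h(x)}}{1-q^{h(x)}}. \]
   Context: $\operatorname{Inv}(n)=\{\pi\in S_n : \pi=\pi^{-1}\}$ is the set of involutions in the symmetric group $S_n$, with the convention $S_0=\operatorname{Inv}(0)=\{1\}$ (the identity of the empty set). $\alpha_1(\pi)$ is the number of fixed points of $\pi$. The right-hand sum is over all partitions $\lambda$ of $n$; $f^\lambda$ is the number of standard Young tableaux of shape $\lambda$; $x\in\lambda$ ranges over cells of the Young diagram of $\lambda$ and $h(x)$ is the hook length of $x$ (cells to the right in its row, plus cells below in its column, plus one). *)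

theory Defs
  imports
    "HOL-Library.FuncSet"
    "HOL-Combinatorics.Permutations"
    "HOL-Computational_Algebra.Polynomial"
    "HOL-Computational_Algebra.Fraction_Field"
begin

definition involutions :: "nat \<Rightarrow> (nat \<Rightarrow> nat) set" where
  "involutions n = {p. p permutes {1..n} \<and> p = inv p}"

(* Permutations of {1..n} are functions on all of nat that are the identity outside {1..n},
   so the fixed points must be counted inside {1..n} only. *)
definition num_fixed_points :: "nat \<Rightarrow> (nat \<Rightarrow> nat) \<Rightarrow> nat" where
  "num_fixed_points n p = card {i \<in> {1..n}. p i = i}"

definition partitions :: "nat \<Rightarrow> nat list set" where
  "partitions n = {xs. sorted_wrt (\<ge>) xs \<and> (\<forall>x \<in> set xs. 0 < x) \<and> sum_list xs = n}"

(* English notation: the cell (i, j) lies in row i (counted downwards) and column j,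
   both counted from 0. *)
definition young_diagram :: "nat list \<Rightarrow> (nat \<times> nat) set" where
  "young_diagram xs = {(i, j). i < length xs \<and> j < xs ! i}"

(* Tableaux are extensional (undefined outside the diagram), so that each filling of the
   diagram corresponds to exactly one function. *)
definition standard_young_tableaux :: "nat list \<Rightarrow> (nat \<times> nat \<Rightarrow> nat) set" where
  "standard_young_tableaux xs =
     {T \<in> extensional (young_diagram xs).
        bij_betw T (young_diagram xs) {1..sum_list xs} \<and>
        (\<forall>i j j'. (i, j) \<in> young_diagram xs \<and> (i, j') \<in> young_diagram xs \<and> j < j'
                   \<longrightarrow> T (i, j) < T (i, j')) \<and>
        (\<forall>i i' j. (i, j) \<in> young_diagram xs \<and> (i', j) \<in> young_diagram xs \<and> i < i'
                   \<longrightarrow> T (i, j) < T (i', j))}"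

definition num_syt :: "nat list \<Rightarrow> nat" where
  "num_syt xs = card (standard_young_tableaux xs)"

definition hook_length :: "nat list \<Rightarrow> nat \<times> nat \<Rightarrow> nat" where
  "hook_length xs = (\<lambda>(i, j).
     card {j'. j < j' \<and> (i, j') \<in> young_diagram xs} +
     card {i'. i < i' \<and> (i', j) \<in> young_diagram xs} + 1)"

(* The indeterminate of the field of rational functions over the rationals. *)
definition ratfun_var :: "rat poly fract" where
  "ratfun_var = Fract [:0, 1:] 1"

lemma finite_involutions: "finite (involutions n)"
  by (rule finite_subset[OF _ finite_permutations[of "{1..n}"]]) (auto simp: involutions_def)

lemma finite_partitions: "finite (partitions n)"
proof -
  have "length xs \<le> sum_list xs" if "\<forall>x \<in> set xs. 0 < x" for xs :: "nat list"
    using that by (induction xs) auto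
  then have "partitions n \<subseteq> {xs. set xs \<subseteq> {..n} \<and> length xs \<le> n}"
    by (auto simp: partitions_def intro: member_le_sum_list)
  then show ?thesis
    by (rule finite_subset) (rule finite_lists_length_le, simp)
qed

lemma finite_young_diagram: "finite (young_diagram xs)"
proof -
  have "young_diagram xs = (SIGMA i:{..<length xs}. {..<xs ! i})"
    by (auto simp: young_diagram_def)
  then show ?thesis by simp
qed

lemma finite_standard_young_tableaux: "finite (standard_young_tableaux xs)"
proof (rule finite_subset)
  show "standard_young_tableaux xs \<subseteq> young_diagram xs \<rightarrow>\<^sub>E {1..sum_list xs}"
    by (auto simp: standard_young_tableaux_def PiE_def bij_betw_def)
  show "finite (young_diagram xs \<rightarrow>\<^sub>E {1..sum_list xs})"
    by (intro finite_PiE finite_young_diagram) simp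
qed

lemma one_minus_ratfun_var_power_nonzero:
  assumes "0 < k"
  shows "1 - ratfun_var ^ k \<noteq> 0"
proof
  have pow: "ratfun_var ^ k = Fract (monom 1 k) 1" for k
    by (induction k) (auto simp: ratfun_var_def One_fract_def monom_Suc mult.commute)
  assume "1 - ratfun_var ^ k = 0"
  then have "ratfun_var ^ k = 1"
    by simp
  then have "Fract (monom 1 k :: rat poly) 1 = Fract 1 1"
    by (simp only: pow One_fract_def)
  then have "(monom 1 k :: rat poly) = 1"
    by (simp add: eq_fract)
  with assms show False
    by (metis degree_1 degree_monom_eq less_irrefl one_neq_zero)
qed

end

(* Write t for (1+q)/(1-q). The left-hand side satisfies I(n+2) = t I(n+1) + (n+1) I(n).

   For a function K on partitions let U K and D K be its sums over all ways to add, respectively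
   remove, one cell, so that U D = D U + 1. Counting standard tableaux by growth turns the
   right-hand side into (U^n H)(empty), where H is the hook product, and the recursion for it
   follows from U D = D U + 1 and the local identity U H = t H + D H.

   In terms of the beta numbers b_1 > ... > b_L = 0 of a partition, H becomes a product over
   pairs of beta numbers, and the local identity is the case S = {-1} + {q^b_i} + {-q^(b_i+1)} of
     sum_{z in S} prod_{y in S - z} (y + z) / (y - z) = 1   (|S| odd). *)

theory Submission
  imports Defs
begin

section \<open>An interpolation identity\<close>

text \<open>Adding a cell changes hook lengths throughout its row and column, so its effect on the
  hook product looks global. In beta numbers it is local: one \<open>b_i\<close> moves by one, and
  only the factors involving it change. Dividing the local identity by H thus leaves one rational
  expression in the q^b_k for each row. Rows where no cell can be added or removed need no separate
  treatment: the moved \<open>b_i\<close> collides with a neighbour (or would drop below 0) and its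
  term is zero, so the sums may run over all rows.

  The points of S are chosen so that the quotients (y + z) / (y - z) reproduce these terms. Points
  of the same kind give the denominators, points of opposite kind the shifted numerators, and -1
  gives the change in the weights of 1, ..., b_i. The two points of one and the same row give (1 -
  q) / (1 + q) = 1 / t up to sign, which is how t enters.

  No hook formula for the number of tableaux is used; tableaux enter only through their
  growth.\<close>

lemma coeff_prod_linear:
  fixes f :: "'b \<Rightarrow> 'a::field"
  assumes "finite S" "c \<noteq> 0"
  shows "coeff (\<Prod>y\<in>S. [:f y, c:]) (card S) = c ^ card S \<and> degree (\<Prod>y\<in>S. [:f y, c:]) = card S"
proof -
  have deg: "degree (\<Prod>y\<in>S. [:f y, c:]) = card S"
    using assms by (subst degree_prod_eq_sum_degree) auto
  moreover have "lead_coeff (\<Prod>y\<in>S. [:f y, c:]) = c ^ card S"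
    using assms by (simp add: lead_coeff_prod)
  ultimately show ?thesis by simp
qed

text \<open>Lagrange interpolation read off at the coefficient of degree \<open>m\<close>: the
  interpolant \<open>Q\<close> is a combination of monic polynomials of degree \<open>m\<close>, and
  \<open>P - Q\<close> would have more roots than its degree allows if it were nonzero.\<close>

lemma coeff_eq_sum_divided_difference:
  fixes P :: "'a::field poly"
  assumes S: "finite S" "card S = Suc m" and deg: "degree P \<le> m"
  shows "coeff P m = (\<Sum>z\<in>S. poly P z / (\<Prod>y\<in>S-{z}. z - y))"
proof -
  define w where "w z = poly P z / (\<Prod>y\<in>S-{z}. z - y)" for z
  define Q where "Q = (\<Sum>z\<in>S. smult (w z) (\<Prod>y\<in>S-{z}. [:- y, 1:]))"
  have card: "card (S - {z}) = m" if "z \<in> S" for z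
    using S that by simp
  have lin: "coeff (\<Prod>y\<in>S-{z}. [:- y, 1:]) m = 1 \<and> degree (\<Prod>y\<in>S-{z}. [:- y, 1:]) = m" if "z \<in> S" for z
    using coeff_prod_linear[of "S-{z}" 1 uminus] card[OF that] S by simp
  have "coeff Q m = (\<Sum>z\<in>S. w z)"
    unfolding Q_def coeff_sum using lin by (intro sum.cong) auto
  moreover have "P = Q"
  proof (rule ccontr)
    assume "P \<noteq> Q"
    have root: "poly (P - Q) x = 0" if x: "x \<in> S" for x
    proof -
      have "poly Q x = (\<Sum>z\<in>S. w z * (\<Prod>y\<in>S-{z}. x - y))"
        by (simp add: Q_def poly_sum poly_prod)
      also have "\<dots> = (\<Sum>z\<in>{x}. w z * (\<Prod>y\<in>S-{z}. x - y))"
        using x S by (intro sum.mono_neutral_right) (auto intro!: prod_zero)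
      also have "\<dots> = poly P x"
        using S by (simp add: w_def)
      finally show ?thesis by simp
    qed
    have "degree Q \<le> m"
      unfolding Q_def using S lin by (intro degree_sum_le) (auto intro: order_trans[OF degree_smult_le])
    with deg have "degree (P - Q) \<le> m"
      by (rule degree_diff_le)
    moreover have "card S \<le> card {x. poly (P - Q) x = 0}"
      using root \<open>P \<noteq> Q\<close> by (intro card_mono poly_roots_finite) auto
    ultimately show False
      using card_poly_roots_bound[of "P - Q"] \<open>P \<noteq> Q\<close> S by simp
  qed
  ultimately show ?thesis by (simp add: w_def)
qed

text \<open>Interpolate the polynomial \<open>(\<Prod>(y + X) - \<Prod>(y - X)) / X\<close> at the points of \<open>S\<close>.\<close>

lemma sum_prod_sum_over_difference:
  fixes S :: "'a::field set"
  assumes S: "finite S" "odd (card S)" "0 \<notin> S" and two: "(2::'a) \<noteq> 0"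
  shows "(\<Sum>z\<in>S. \<Prod>y\<in>S-{z}. (y + z) / (y - z)) = 1"
proof -
  obtain m where m: "card S = Suc m" "even m"
    using S by (metis even_Suc oddE Suc_eq_plus1 dvd_triv_left)
  define F where "F = (\<Prod>y\<in>S. [:y, 1:]) - (\<Prod>y\<in>S. [:y, - 1:])"
  obtain R where R: "F = pCons 0 R"
  proof -
    obtain a R where aR: "F = pCons a R" by (cases F)
    have "poly F 0 = 0" by (simp add: F_def poly_prod)
    with aR have "a = 0" by simp
    with aR that show ?thesis by simp
  qed
  \<comment> \<open>Since \<open>card S\<close> is odd, the two products have leading coefficients 1
    and -1, which differ by 2; for an even number they would cancel.\<close>
  have c: "coeff F (Suc m) = 2" and degF: "degree F \<le> Suc m"
    using coeff_prod_linear[of S 1 "\<lambda>y. y"] coeff_prod_linear[of S "-1" "\<lambda>y. y"] S m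
    by (auto simp: F_def intro!: degree_diff_le)
  have degR: "degree R \<le> m"
    using degF R by (cases "R = 0") auto
  have "2 = coeff R m" using c R by simp
  also have "\<dots> = (\<Sum>z\<in>S. poly R z / (\<Prod>y\<in>S-{z}. z - y))"
    using S m degR by (intro coeff_eq_sum_divided_difference) auto
  also have "\<dots> = (\<Sum>z\<in>S. 2 * (\<Prod>y\<in>S-{z}. (y + z) / (y - z)))"
  proof (rule sum.cong)
    fix z assume z: "z \<in> S"
    have "z * poly R z = poly F z" by (simp add: R)
    also have "\<dots> = (\<Prod>y\<in>S. y + z) - (\<Prod>y\<in>S. y - z)"
      by (simp add: F_def poly_prod)
    also have "(\<Prod>y\<in>S. y - z) = 0" using z S by (auto intro!: prod_zero)
    \<comment> \<open>The factor at \<open>y = z\<close> is \<open>2 * z\<close>: its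
      \<open>z\<close> cancels against the division by X, its 2 against the leading
      coefficient.\<close>
    also have "(\<Prod>y\<in>S. y + z) = z * (2 * (\<Prod>y\<in>S-{z}. y + z))"
      using z S by (subst prod.remove[of _ z]) (auto simp: algebra_simps)
    finally have 1: "poly R z = 2 * (\<Prod>y\<in>S-{z}. y + z)"
      using z S(3) by auto
    \<comment> \<open>An even number \<open>m\<close> of factors changes sign.\<close>
    have "(\<Prod>y\<in>S-{z}. z - y) = (\<Prod>y\<in>S-{z}. (- 1) * (y - z))"
      by simp
    also have "\<dots> = (\<Prod>y\<in>S-{z}. y - z)"
      unfolding prod.distrib using z S m by simp
    finally show "poly R z / (\<Prod>y\<in>S-{z}. z - y) = 2 * (\<Prod>y\<in>S-{z}. (y + z) / (y - z))"
      by (simp add: 1 prod_dividef)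
  qed simp
  finally have "2 * (\<Sum>z\<in>S. \<Prod>y\<in>S-{z}. (y + z) / (y - z)) = 2 * 1"
    by (simp add: sum_distrib_left)
  then show ?thesis using two by (simp only: mult_cancel_left) simp
qed

section \<open>Counting involutions by fixed points\<close>

text \<open>Arbitrary sets are allowed because deleting a 2-cycle from an interval need not leave an
  interval. Demanding \<open>p (p x) = x\<close> everywhere makes bijectivity automatic.\<close>

definition involutions_on :: "'b set \<Rightarrow> ('b \<Rightarrow> 'b) set" where
  "involutions_on A = {p. (\<forall>x. p (p x) = x) \<and> (\<forall>x. x \<notin> A \<longrightarrow> p x = x)}"

lemma involutions_on_permutes: "p \<in> involutions_on A \<Longrightarrow> p permutes A"
  unfolding involutions_on_def permutes_def by (simp; metis)

definition weighted_involutions :: "'a::comm_ring_1 \<Rightarrow> 'b set \<Rightarrow> 'a" where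
  "weighted_involutions t A = (\<Sum>p \<in> involutions_on A. t ^ card {i\<in>A. p i = i})"

text \<open>Classify by the image of \<open>a\<close>: if \<open>a\<close> is fixed it contributes
  the factor \<open>t\<close>; otherwise it is removed together with its partner \<open>j\<close>,
  and neither of the two counts as a fixed point.\<close>

lemma weighted_involutions_insert:
  assumes A: "finite A" "a \<notin> A"
  shows "weighted_involutions t (insert a A) =
    t * weighted_involutions t A + (\<Sum>j\<in>A. weighted_involutions t (A - {j}))"
proof -
  let ?w = "\<lambda>A p. t ^ card {i\<in>A. p i = i}"
  define J where "J b = {p \<in> involutions_on (insert a A). p a = b}" for b
  have fin: "finite (involutions_on (insert a A))"
    using A by (intro finite_subset[OF _ finite_permutations[of "insert a A"]])
      (auto dest: involutions_on_permutes)
  have "weighted_involutions t (insert a A) = (\<Sum>b\<in>insert a A. sum (?w (insert a A)) (J b))"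
    unfolding weighted_involutions_def J_def using A fin
    by (intro sum.group[symmetric]) (auto dest!: involutions_on_permutes permutes_in_image[of _ _ a])
  also have "\<dots> = sum (?w (insert a A)) (J a) + (\<Sum>b\<in>A. sum (?w (insert a A)) (J b))"
    using A by simp
  also have "sum (?w (insert a A)) (J a) = t * weighted_involutions t A"
  proof -
    have "J a = involutions_on A"
      unfolding J_def involutions_on_def using A by auto
    moreover have "?w (insert a A) p = t * ?w A p" if "p \<in> J a" for p
    proof -
      have "{i\<in>insert a A. p i = i} = insert a {i\<in>A. p i = i}"
        using that by (auto simp: J_def)
      with A show ?thesis by simp
    qed
    ultimately show ?thesis
      by (simp add: weighted_involutions_def sum_distrib_left)
  qed
  also have "(\<Sum>b\<in>A. sum (?w (insert a A)) (J b)) = (\<Sum>j\<in>A. weighted_involutions t (A - {j}))"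
  proof (rule sum.cong)
    fix b assume b: "b \<in> A"
    then have ab: "a \<noteq> b" using A by auto
    show "sum (?w (insert a A)) (J b) = weighted_involutions t (A - {b})"
      unfolding weighted_involutions_def
    proof (rule sum.reindex_bij_witness[where i="\<lambda>p. p(a := b, b := a)" and j="\<lambda>p. p(a := a, b := b)"])
      fix p assume "p \<in> J b"
      then have p: "\<And>x. p (p x) = x" "p a = b" "\<And>x. x \<notin> insert a A \<Longrightarrow> p x = x"
        by (auto simp: J_def involutions_on_def)
      then have pb: "p b = a" by metis
      have off: "p x \<noteq> a" "p x \<noteq> b" if "x \<noteq> a" "x \<noteq> b" for x
        using p(1)[of x] p(2) pb that by auto
      show "(p(a := a, b := b))(a := b, b := a) = p"
        using p pb ab by auto
      show "p(a := a, b := b) \<in> involutions_on (A - {b})"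
        using p(1,3) off by (auto simp: involutions_on_def)
      have "{i\<in>insert a A. p i = i} = {i \<in> A - {b}. (p(a := a, b := b)) i = i}"
        using p pb ab A by auto
      then show "?w (A - {b}) (p(a := a, b := b)) = ?w (insert a A) p" by simp
    next
      fix p assume "p \<in> involutions_on (A - {b})"
      then have p: "\<And>x. p (p x) = x" "\<And>x. x \<notin> A - {b} \<Longrightarrow> p x = x"
        by (auto simp: involutions_on_def)
      have fixp: "p a = a" "p b = b"
        using p(2) A by auto
      then show "(p(a := b, b := a))(a := a, b := b) = p" by auto
      have off: "p x \<noteq> a" "p x \<noteq> b" if "x \<noteq> a" "x \<noteq> b" for x
        using p(1)[of x] fixp that by auto
      show "p(a := b, b := a) \<in> J b"
        using p off ab b by (auto simp: J_def involutions_on_def)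
    qed
  qed simp
  finally show ?thesis .
qed

text \<open>Hermite polynomials with all signs made positive: \<open>(-i)^n He_n(i t)\<close> in the
  probabilists' normalisation.\<close>

fun involution_poly :: "'a::comm_ring_1 \<Rightarrow> nat \<Rightarrow> 'a" where
  "involution_poly t 0 = 1"
| "involution_poly t (Suc 0) = t"
| "involution_poly t (Suc (Suc n)) = t * involution_poly t (Suc n) + of_nat (Suc n) * involution_poly t n"

lemma weighted_involutions_eq:
  "finite A \<Longrightarrow> weighted_involutions t A = involution_poly t (card A)"
proof (induction "card A" arbitrary: A rule: less_induct)
  case less
  show ?case
  proof (cases "A = {}")
    case True
    have "involutions_on ({}::'a set) = {id}" by (auto simp: involutions_on_def)
    with True show ?thesis by (simp add: weighted_involutions_def)
  next
    case False
    then obtain a B where AB: "A = insert a B" "a \<notin> B" by (metis mk_disjoint_insert ex_in_conv)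
    with less.prems have B: "finite B" by simp
    have 1: "weighted_involutions t B = involution_poly t (card B)"
      using less.hyps[of B] AB B by simp
    have 2: "weighted_involutions t (B - {j}) = involution_poly t (card B - 1)" if "j \<in> B" for j
      using less.hyps[of "B - {j}"] AB B that by (simp add: card_Diff_singleton_if)
    \<comment> \<open>For empty \<open>B\<close> the index \<open>card B - 1\<close> truncates to 0,
      which is harmless because its coefficient \<open>of_nat (card B)\<close> vanishes.\<close>
    have "weighted_involutions t A = t * involution_poly t (card B) + of_nat (card B) * involution_poly t (card B - 1)"
      unfolding AB(1) weighted_involutions_insert[OF B AB(2)] using 1 2 by simp
    then show ?thesis
      using AB B by (cases "card B") auto
  qed
qed

lemma sum_involutions:
  "(\<Sum>p \<in> involutions n. t ^ num_fixed_points n p) = involution_poly t n"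
proof -
  have "p \<in> involutions n \<longleftrightarrow> p \<in> involutions_on {1..n}" for p
  proof
    assume p: "p \<in> involutions n"
    then have perm: "p permutes {1..n}" and inv: "p = inv p"
      by (auto simp: involutions_def)
    have "p (p x) = x" for x
      using permutes_inverses(1)[OF perm, of x] inv by simp
    then show "p \<in> involutions_on {1..n}"
      using permutes_not_in[OF perm] by (simp add: involutions_on_def)
  next
    assume p: "p \<in> involutions_on {1..n}"
    then have "inv p = p"
      by (intro inv_unique_comp) (auto simp: involutions_on_def fun_eq_iff)
    with involutions_on_permutes[OF p] show "p \<in> involutions n"
      by (simp add: involutions_def)
  qed
  then have "involutions n = involutions_on {1..n}" by blast
  then show ?thesis
    using weighted_involutions_eq[of "{1..n}" t]
    by (simp add: weighted_involutions_def num_fixed_points_def)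
qed

section \<open>Adding and removing cells\<close>

text \<open>A partition is the function of its row lengths, zero beyond the last part. Adding or
  removing a cell is then a single update, with no case split for a row that appears or
  disappears.\<close>

definition diagram :: "(nat \<Rightarrow> nat) \<Rightarrow> (nat \<times> nat) set" where
  "diagram p = {(i, j). j < p i}"

definition is_partition :: "(nat \<Rightarrow> nat) \<Rightarrow> bool" where
  "is_partition p \<longleftrightarrow> antimono p \<and> finite (diagram p)"

text \<open>A row changes only at its right end, so rows index the possible moves. The top row needs
  its own disjunct because \<open>0 - 1 = 0\<close>.\<close>

definition addable :: "(nat \<Rightarrow> nat) \<Rightarrow> nat set" where
  "addable p = {i. i = 0 \<or> p i < p (i - 1)}"

definition removable :: "(nat \<Rightarrow> nat) \<Rightarrow> nat set" where
  "removable p = {i. p (Suc i) < p i}"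

abbreviation add_cell :: "(nat \<Rightarrow> nat) \<Rightarrow> nat \<Rightarrow> nat \<Rightarrow> nat" where
  "add_cell p i \<equiv> p(i := Suc (p i))"

abbreviation remove_cell :: "(nat \<Rightarrow> nat) \<Rightarrow> nat \<Rightarrow> nat \<Rightarrow> nat" where
  "remove_cell p i \<equiv> p(i := p i - 1)"

definition sum_up :: "((nat \<Rightarrow> nat) \<Rightarrow> 'a::comm_ring_1) \<Rightarrow> (nat \<Rightarrow> nat) \<Rightarrow> 'a" where
  "sum_up K p = (\<Sum>i\<in>addable p. K (add_cell p i))"

definition sum_down :: "((nat \<Rightarrow> nat) \<Rightarrow> 'a::comm_ring_1) \<Rightarrow> (nat \<Rightarrow> nat) \<Rightarrow> 'a" where
  "sum_down K p = (\<Sum>i\<in>removable p. K (remove_cell p i))"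

lemma is_partition_le: "is_partition p \<Longrightarrow> i \<le> j \<Longrightarrow> p j \<le> p i"
  unfolding is_partition_def by (blast intro: antimonoD)

text \<open>Below the top, a row can grow exactly when the row above it can shrink. The surplus of
  one move is the origin of the summand 1 in the commutation relation.\<close>

lemma addable_eq: "addable p = insert 0 (Suc ` removable p)"
proof -
  have "i \<in> addable p \<longleftrightarrow> i \<in> insert 0 (Suc ` removable p)" for i
    by (cases i) (auto simp: addable_def removable_def)
  then show ?thesis by blast
qed

lemma finite_removable:
  assumes "is_partition p" shows "finite (removable p)"
proof (rule finite_subset)
  show "removable p \<subseteq> fst ` diagram p"
    by (force simp: removable_def diagram_def)
  show "finite (fst ` diagram p)"
    using assms by (simp add: is_partition_def)
qed

lemma finite_addable: "is_partition p \<Longrightarrow> finite (addable p)"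
  by (simp add: addable_eq finite_removable)

lemma card_addable: "is_partition p \<Longrightarrow> card (addable p) = Suc (card (removable p))"
  by (subst addable_eq, subst card_insert_disjoint) (auto simp: finite_removable card_image)

lemma diagram_add_cell: "diagram (add_cell p i) = insert (i, p i) (diagram p)"
  by (auto simp: diagram_def split: if_splits)

lemma diagram_remove_cell: "diagram (remove_cell p i) = diagram p - {(i, p i - 1)}"
  by (auto simp: diagram_def split: if_splits)

lemma is_partition_add_cell:
  assumes p: "is_partition p" and i: "i \<in> addable p"
  shows "is_partition (add_cell p i)"
proof -
  have "p (Suc k) \<le> p k" for k
    using p by (simp add: is_partition_le)
  then have "add_cell p i (Suc k) \<le> add_cell p i k" for k
    using i by (auto simp: addable_def le_SucI)
  then have "antimono (add_cell p i)"
    by (simp add: antimono_iff_le_Suc)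
  with p show ?thesis by (simp add: is_partition_def diagram_add_cell)
qed

lemma is_partition_remove_cell:
  assumes p: "is_partition p" and i: "i \<in> removable p"
  shows "is_partition (remove_cell p i)"
proof -
  have "p (Suc k) \<le> p k" for k
    using p by (simp add: is_partition_le)
  then have "remove_cell p i (Suc k) \<le> remove_cell p i k" for k
    using i by (auto simp: removable_def intro: order_trans[OF diff_le_self])
  then have "antimono (remove_cell p i)"
    by (simp add: antimono_iff_le_Suc)
  with p show ?thesis by (simp only: is_partition_def diagram_remove_cell finite_Diff)
qed

lemma removable_add_cell: "is_partition p \<Longrightarrow> i \<in> removable (add_cell p i)"
  by (simp add: removable_def is_partition_le less_Suc_eq_le)

lemma addable_remove_cell:
  assumes "is_partition p" "i \<in> removable p"
  shows "i \<in> addable (remove_cell p i)"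
proof (cases i)
  case (Suc k)
  have "p (Suc k) \<le> p k" using assms(1) by (simp add: is_partition_le)
  with Suc assms(2) show ?thesis by (simp add: addable_def removable_def)
qed (simp add: addable_def)

text \<open>Moves in two different rows commute and match up. Moves in the same row return to
  \<open>p\<close>, once per addable row in one order and once per removable row in the
  other.\<close>

lemma sum_up_sum_down:
  assumes p: "is_partition p"
  shows "sum_up (sum_down K) p = sum_down (sum_up K) p + K p"
proof -
  define A where "A = (SIGMA i:addable p. removable (add_cell p i) - {i})"
  define B where "B = (SIGMA j:removable p. addable (remove_cell p j) - {j})"
  have "sum_up (sum_down K) p = (\<Sum>i\<in>addable p. K p +
      (\<Sum>j\<in>removable (add_cell p i) - {i}. K (remove_cell (add_cell p i) j)))"
    unfolding sum_up_def sum_down_def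
  proof (rule sum.cong)
    fix i assume i: "i \<in> addable p"
    show "(\<Sum>j\<in>removable (add_cell p i). K (remove_cell (add_cell p i) j)) = K p +
      (\<Sum>j\<in>removable (add_cell p i) - {i}. K (remove_cell (add_cell p i) j))"
      using removable_add_cell[OF p, of i] finite_removable[OF is_partition_add_cell[OF p i]]
      by (subst sum.remove[of _ i]) auto
  qed simp
  also have "\<dots> = of_nat (card (addable p)) * K p +
      (\<Sum>(i, j)\<in>A. K (remove_cell (add_cell p i) j))"
    unfolding A_def using p
    by (simp add: sum.distrib sum.Sigma finite_addable finite_removable is_partition_add_cell
        del: fun_upd_apply One_nat_def)
  also have "(\<Sum>(i, j)\<in>A. K (remove_cell (add_cell p i) j)) =
      (\<Sum>(j, i)\<in>B. K (add_cell (remove_cell p j) i))"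
  proof (rule sum.reindex_bij_witness[where i=prod.swap and j=prod.swap])
    fix x assume "x \<in> A"
    then obtain i j where x: "x = (i, j)" "i \<in> addable p" "j \<in> removable (add_cell p i)" "j \<noteq> i"
      by (auto simp: A_def)
    \<comment> \<open>The two moves interact only when \<open>i = Suc j\<close>; both orders then
      require that row \<open>j\<close> exceed row \<open>i\<close> by at least two cells.\<close>
    show "prod.swap x \<in> B"
      using x by (cases i) (auto simp: B_def addable_def removable_def split: if_splits)
    show "(case prod.swap x of (j, i) \<Rightarrow> K (add_cell (remove_cell p j) i)) =
        (case x of (i, j) \<Rightarrow> K (remove_cell (add_cell p i) j))"
      using x by (simp add: fun_upd_twist)
  next
    fix x assume "x \<in> B"
    then obtain i j where x: "x = (j, i)" "j \<in> removable p" "i \<in> addable (remove_cell p j)" "i \<noteq> j"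
      by (auto simp: B_def)
    show "prod.swap x \<in> A"
      using x by (cases i) (auto simp: A_def addable_def removable_def split: if_splits)
  qed auto
  also have "of_nat (card (addable p)) * K p + (\<Sum>(j, i)\<in>B. K (add_cell (remove_cell p j) i)) =
      (of_nat (card (removable p)) * K p + (\<Sum>(j, i)\<in>B. K (add_cell (remove_cell p j) i))) + K p"
    using p by (simp add: card_addable algebra_simps)
  also have "of_nat (card (removable p)) * K p + (\<Sum>(j, i)\<in>B. K (add_cell (remove_cell p j) i)) =
      (\<Sum>j\<in>removable p. K p +
        (\<Sum>i\<in>addable (remove_cell p j) - {j}. K (add_cell (remove_cell p j) i)))"
    unfolding B_def using p
    by (simp add: sum.distrib sum.Sigma finite_addable finite_removable is_partition_remove_cell
        del: fun_upd_apply One_nat_def)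
  also have "\<dots> = sum_down (sum_up K) p"
    unfolding sum_up_def sum_down_def
  proof (rule sum.cong)
    fix j assume j: "j \<in> removable p"
    then have "add_cell (remove_cell p j) j = p"
      by (auto simp: removable_def)
    then show "K p + (\<Sum>i\<in>addable (remove_cell p j) - {j}. K (add_cell (remove_cell p j) i)) =
        (\<Sum>i\<in>addable (remove_cell p j). K (add_cell (remove_cell p j) i))"
      using addable_remove_cell[OF p j] finite_addable[OF is_partition_remove_cell[OF p j]]
      by (subst (2) sum.remove[of _ j]) auto
  qed simp
  finally show ?thesis .
qed

lemma sum_up_cong:
  assumes "is_partition p" "\<And>p. is_partition p \<Longrightarrow> K p = K' p"
  shows "sum_up K p = sum_up K' p"
  unfolding sum_up_def using assms by (intro sum.cong) (auto intro: is_partition_add_cell)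

lemma sum_up_linear: "sum_up (\<lambda>p. c * K p + K' p) p = c * sum_up K p + sum_up K' p"
  by (simp add: sum_up_def sum.distrib sum_distrib_left)

lemma funpow_sum_up_linear:
  "(sum_up ^^ n) (\<lambda>p. c * K p + K' p) p = c * (sum_up ^^ n) K p + (sum_up ^^ n) K' p"
proof (induction n arbitrary: p)
  case (Suc n)
  then have "(sum_up ^^ n) (\<lambda>p. c * K p + K' p) =
      (\<lambda>p. c * (sum_up ^^ n) K p + (sum_up ^^ n) K' p)" by blast
  then show ?case by (simp add: sum_up_linear)
qed simp

lemma funpow_sum_up_cong:
  assumes "is_partition p" "\<And>p. is_partition p \<Longrightarrow> K p = K' p"
  shows "(sum_up ^^ n) K p = (sum_up ^^ n) K' p"
  using assms(1) by (induction n arbitrary: p) (auto intro: sum_up_cong assms(2))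

text \<open>Commuting with \<open>sum_down\<close> acts as a derivation: passing each of the
  \<open>Suc n\<close> copies of \<open>sum_up\<close> leaves one extra summand.\<close>

lemma funpow_sum_up_sum_down:
  assumes "is_partition p"
  shows "(sum_up ^^ Suc n) (sum_down K) p =
    sum_down ((sum_up ^^ Suc n) K) p + of_nat (Suc n) * (sum_up ^^ n) K p"
  using assms
proof (induction n arbitrary: p)
  case 0
  then show ?case by (simp add: sum_up_sum_down)
next
  case (Suc n)
  let ?L = "(sum_up ^^ Suc n) K"
  have "(sum_up ^^ Suc (Suc n)) (sum_down K) p = sum_up ((sum_up ^^ Suc n) (sum_down K)) p"
    by simp
  also have "\<dots> = sum_up (\<lambda>p. of_nat (Suc n) * (sum_up ^^ n) K p + sum_down ?L p) p"
    by (rule sum_up_cong[OF Suc.prems]) (simp only: Suc.IH add.commute)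
  also have "\<dots> = of_nat (Suc n) * ?L p + sum_up (sum_down ?L) p"
    by (simp only: sum_up_linear) simp
  also have "sum_up (sum_down ?L) p = sum_down (sum_up ?L) p + ?L p"
    by (rule sum_up_sum_down[OF Suc.prems])
  finally show ?case by (simp add: algebra_simps)
qed

lemma is_partition_empty: "is_partition (\<lambda>_. 0)"
  by (simp add: is_partition_def diagram_def antimono_def)

text \<open>Nothing can be removed from the empty partition. Once \<open>sum_down\<close> has moved
  past all copies of \<open>sum_up\<close>, only the commutator term survives there, and it is the
  second term of the recursion.\<close>

lemma funpow_sum_up_eq_involution_poly:
  assumes "\<And>p. is_partition p \<Longrightarrow> sum_up H p = t * H p + sum_down H p"
    and "H (\<lambda>_. 0) = 1"
  shows "(sum_up ^^ n) H (\<lambda>_. 0) = involution_poly t n"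
proof -
  have down0: "sum_down K (\<lambda>_. 0) = 0" for K :: "(nat \<Rightarrow> nat) \<Rightarrow> 'a"
    by (simp add: sum_down_def removable_def)
  have "(sum_up ^^ Suc n) H (\<lambda>_. 0) =
      t * (sum_up ^^ n) H (\<lambda>_. 0) + (sum_up ^^ n) (sum_down H) (\<lambda>_. 0)" for n
  proof -
    have "(sum_up ^^ Suc n) H (\<lambda>_. 0) = (sum_up ^^ n) (sum_up H) (\<lambda>_. 0)"
      by (simp only: funpow_Suc_right o_apply)
    also have "\<dots> = (sum_up ^^ n) (\<lambda>p. t * H p + sum_down H p) (\<lambda>_. 0)"
      by (rule funpow_sum_up_cong[OF is_partition_empty assms(1)])
    finally show ?thesis by (simp only: funpow_sum_up_linear)
  qed
  note step = this
  show ?thesis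
  proof (induction n rule: less_induct)
    case (less n)
    consider "n = 0" | "n = Suc 0" | m where "n = Suc (Suc m)"
      by (metis nat.exhaust)
    then show ?case
    proof cases
      case 2
      then show ?thesis using step[of 0] by (simp add: assms(2) down0)
    next
      case (3 m)
      have "(sum_up ^^ Suc m) (sum_down H) (\<lambda>_. 0) = of_nat (Suc m) * (sum_up ^^ m) H (\<lambda>_. 0)"
        by (simp only: funpow_sum_up_sum_down[OF is_partition_empty] down0) simp
      then show ?thesis
        using step[of "Suc m"] less.IH[of m] less.IH[of "Suc m"] 3 by simp
    qed (simp add: assms(2))
  qed
qed

section \<open>Growth of standard tableaux\<close>

text \<open>Any set of cells is allowed, so that the cell with the largest entry can be deleted
  without naming the partition that is left.\<close>

definition fillings :: "(nat \<times> nat) set \<Rightarrow> (nat \<times> nat \<Rightarrow> nat) set" where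
  "fillings D =
     {T \<in> extensional D.
        bij_betw T D {1..card D} \<and>
        (\<forall>i j j'. (i, j) \<in> D \<and> (i, j') \<in> D \<and> j < j' \<longrightarrow> T (i, j) < T (i, j')) \<and>
        (\<forall>i i' j. (i, j) \<in> D \<and> (i', j) \<in> D \<and> i < i' \<longrightarrow> T (i, j) < T (i', j))}"

definition corners :: "(nat \<times> nat) set \<Rightarrow> (nat \<times> nat) set" where
  "corners D = {(i, j). (i, j) \<in> D \<and> (\<forall>j'>j. (i, j') \<notin> D) \<and> (\<forall>i'>i. (i', j) \<notin> D)}"

lemma finite_fillings:
  assumes "finite D" shows "finite (fillings D)"
proof (rule finite_subset)
  show "fillings D \<subseteq> D \<rightarrow>\<^sub>E {1..card D}"
    by (auto simp: fillings_def PiE_def bij_betw_def)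
  show "finite (D \<rightarrow>\<^sub>E {1..card D})"
    using assms by (intro finite_PiE) auto
qed

lemma fillings_le_card: "T \<in> fillings D \<Longrightarrow> c \<in> D \<Longrightarrow> T c \<le> card D"
  by (auto simp: fillings_def bij_betw_def)

lemma fillings_max_corner:
  assumes T: "T \<in> fillings D" and c: "c \<in> D" "T c = card D"
  shows "c \<in> corners D"
proof -
  obtain i j where ij: "c = (i, j)" by (cases c)
  have "(i, j') \<notin> D" if "j < j'" for j'
  proof
    assume j': "(i, j') \<in> D"
    with T c that have "T c < T (i, j')" unfolding fillings_def ij by blast
    with fillings_le_card[OF T j'] c show False by simp
  qed
  moreover have "(i', j) \<notin> D" if "i < i'" for i'
  proof
    assume i': "(i', j) \<in> D"
    with T c that have "T c < T (i', j)" unfolding fillings_def ij by blast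
    with fillings_le_card[OF T i'] c show False by simp
  qed
  ultimately show ?thesis
    using c by (simp add: corners_def ij)
qed

lemma restrict_filling:
  assumes D: "finite D" and T: "T \<in> fillings D" and c: "c \<in> D" "T c = card D"
  shows "restrict T (D - {c}) \<in> fillings (D - {c})"
proof -
  have bij: "bij_betw T D {1..card D}" using T by (simp add: fillings_def)
  have "bij_betw T (D - {c}) ({1..card D} - {card D})"
    using bij_betw_DiffI[OF bij, of "{c}" "{card D}"] c D
    by (simp add: bij_betw_def Suc_le_eq card_gt_0_iff) blast
  moreover have "{1..card D} - {card D} = {1..card (D - {c})}"
    using c D by (auto simp: card_Diff_singleton)
  ultimately have "bij_betw (restrict T (D - {c})) (D - {c}) {1..card (D - {c})}"
    by (subst bij_betw_cong[where g=T]) auto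
  moreover have "\<forall>i j j'. (i, j) \<in> D \<and> (i, j') \<in> D \<and> j < j' \<longrightarrow> T (i, j) < T (i, j')"
    and "\<forall>i i' j. (i, j) \<in> D \<and> (i', j) \<in> D \<and> i < i' \<longrightarrow> T (i, j) < T (i', j)"
    using T by (simp_all add: fillings_def)
  ultimately show ?thesis
    by (simp add: fillings_def)
qed

text \<open>A corner has no cell to its right or below it, so the largest entry placed there can
  only be the greater side of a comparison.\<close>

lemma extend_filling:
  assumes D: "finite D" and c: "c \<in> corners D" and T: "T \<in> fillings (D - {c})"
  shows "T(c := card D) \<in> fillings D"
proof -
  let ?T = "T(c := card D)"
  have cD: "c \<in> D" using c by (auto simp: corners_def)
  have card: "card D = Suc (card (D - {c}))"
    using D cD by (metis card.remove)
  have "bij_betw T (D - {c}) {1..card (D - {c})}" using T by (simp add: fillings_def)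
  then have "bij_betw ?T (D - {c}) {1..card (D - {c})}"
    by (subst bij_betw_cong[where g=T]) auto
  then have "bij_betw ?T (insert c (D - {c})) (insert (?T c) {1..card (D - {c})})"
    by (subst notIn_Un_bij_betw3[symmetric, simplified Un_insert_right Un_empty_right]) (auto simp: card)
  moreover have "insert c (D - {c}) = D" using cD by blast
  moreover have "insert (?T c) {1..card (D - {c})} = {1..card D}"
    unfolding card using card by (simp add: atLeastAtMostSuc_conv)
  ultimately have "bij_betw ?T D {1..card D}" by simp
  moreover have "?T \<in> extensional D"
    using T cD by (auto simp: fillings_def extensional_def)
  moreover have lt: "T x < card D" if "x \<in> D" "x \<noteq> c" for x
    using fillings_le_card[OF T, of x] that card by simp
  have "?T (i, j) < ?T (i, j')" if "(i, j) \<in> D" "(i, j') \<in> D" "j < j'" for i j j'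
  proof -
    have "(i, j) \<noteq> c" using that c by (auto simp: corners_def)
    moreover have "T (i, j) < T (i, j')" if "(i, j') \<noteq> c"
      using T that \<open>(i, j) \<noteq> c\<close> \<open>(i, j) \<in> D\<close> \<open>(i, j') \<in> D\<close> \<open>j < j'\<close> by (simp add: fillings_def)
    ultimately show ?thesis using lt that by simp
  qed
  moreover have "?T (i, j) < ?T (i', j)" if "(i, j) \<in> D" "(i', j) \<in> D" "i < i'" for i i' j
  proof -
    have "(i, j) \<noteq> c" using that c by (auto simp: corners_def)
    moreover have "T (i, j) < T (i', j)" if "(i', j) \<noteq> c"
      using T that \<open>(i, j) \<noteq> c\<close> \<open>(i, j) \<in> D\<close> \<open>(i', j) \<in> D\<close> \<open>i < i'\<close> by (simp add: fillings_def)
    ultimately show ?thesis using lt that by simp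
  qed
  ultimately show ?thesis unfolding fillings_def by blast
qed

text \<open>The largest entry sits in a corner. Deleting it leaves a filling of the remaining cells,
  and every such filling extends back in one way.\<close>

lemma card_fillings:
  assumes D: "finite D" "D \<noteq> {}"
  shows "card (fillings D) = (\<Sum>c\<in>corners D. card (fillings (D - {c})))"
proof -
  define M where "M c = {T \<in> fillings D. T c = card D}" for c
  have cD: "c \<in> D" if "c \<in> corners D" for c
    using that by (auto simp: corners_def)
  have "finite (corners D)"
    using D cD by (blast intro: finite_subset)
  have disj: "c = c'" if "T \<in> fillings D" "T c = card D" "T c' = card D" "c \<in> D" "c' \<in> D" for T c c'
    using that by (auto simp: fillings_def bij_betw_def inj_on_def)
  have ex: "\<exists>c\<in>corners D. T c = card D" if T: "T \<in> fillings D" for T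
  proof -
    have "card D \<in> {1..card D}" using D by (simp add: Suc_le_eq card_gt_0_iff)
    also have "{1..card D} = T ` D" using T by (simp add: fillings_def bij_betw_def)
    finally obtain c where "c \<in> D" "T c = card D" by auto
    then show ?thesis using fillings_max_corner[OF T] by blast
  qed
  have "fillings D = (\<Union>c\<in>corners D. M c)"
    using ex by (auto simp: M_def)
  also have "card \<dots> = (\<Sum>c\<in>corners D. card (M c))"
  proof (rule card_UN_disjoint)
    show "\<forall>c\<in>corners D. finite (M c)"
      using finite_fillings[OF D(1)] by (simp add: M_def)
    show "\<forall>c\<in>corners D. \<forall>c'\<in>corners D. c \<noteq> c' \<longrightarrow> M c \<inter> M c' = {}"
      using disj cD unfolding M_def by blast
  qed fact
  also have "\<dots> = (\<Sum>c\<in>corners D. card (fillings (D - {c})))"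
  proof (rule sum.cong)
    fix c assume c: "c \<in> corners D"
    have "bij_betw (\<lambda>T. restrict T (D - {c})) (M c) (fillings (D - {c}))"
    proof (rule bij_betw_byWitness[where f'="\<lambda>T. T(c := card D)"])
      show "\<forall>T\<in>M c. (restrict T (D - {c}))(c := card D) = T"
        by (auto simp: M_def fillings_def extensional_def fun_eq_iff)
      show "\<forall>T\<in>fillings (D - {c}). restrict (T(c := card D)) (D - {c}) = T"
        by (auto simp: fillings_def extensional_def fun_eq_iff)
      show "(\<lambda>T. restrict T (D - {c})) ` M c \<subseteq> fillings (D - {c})"
        using restrict_filling[OF D(1)] cD[OF c] by (simp add: M_def image_subset_iff)
      show "(\<lambda>T. T(c := card D)) ` fillings (D - {c}) \<subseteq> M c"
        using extend_filling[OF D(1) c] by (simp add: M_def image_subset_iff)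
    qed
    then show "card (M c) = card (fillings (D - {c}))"
      by (rule bij_betw_same_card)
  qed simp
  finally show ?thesis .
qed

lemma corners_diagram:
  assumes "is_partition p"
  shows "corners (diagram p) = (\<lambda>i. (i, p i - 1)) ` removable p"
proof -
  have mono: "p i' \<le> p i" if "i \<le> i'" for i i'
    using assms that by (simp add: is_partition_le)
  have "(i, j) \<in> corners (diagram p) \<longleftrightarrow> i \<in> removable p \<and> j = p i - 1" for i j
  proof
    assume "(i, j) \<in> corners (diagram p)"
    then have "j < p i" "\<not> Suc j < p i" "\<not> j < p (Suc i)"
      by (auto simp: corners_def diagram_def)
    then show "i \<in> removable p \<and> j = p i - 1" by (auto simp: removable_def)
  next
    assume a: "i \<in> removable p \<and> j = p i - 1"
    have "\<not> j < p i'" if "i' > i" for i'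
      using a mono[of "Suc i" i'] that by (auto simp: removable_def)
    then show "(i, j) \<in> corners (diagram p)"
      using a by (auto simp: corners_def diagram_def removable_def)
  qed
  then show ?thesis by auto
qed

lemma card_fillings_diagram:
  assumes p: "is_partition p" "diagram p \<noteq> {}"
  shows "card (fillings (diagram p)) = (\<Sum>i\<in>removable p. card (fillings (diagram (remove_cell p i))))"
proof -
  have "card (fillings (diagram p)) = (\<Sum>c\<in>corners (diagram p). card (fillings (diagram p - {c})))"
    using p by (intro card_fillings) (simp_all add: is_partition_def)
  also have "\<dots> = (\<Sum>i\<in>removable p. card (fillings (diagram p - {(i, p i - 1)})))"
    unfolding corners_diagram[OF p(1)] by (subst sum.reindex) (auto simp: inj_on_def)
  finally show ?thesis by (simp only: diagram_remove_cell)
qed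

section \<open>Partitions of a given size, and sums weighted by tableau counts\<close>

definition partitions_of :: "nat \<Rightarrow> (nat \<Rightarrow> nat) set" where
  "partitions_of n = {p. is_partition p \<and> card (diagram p) = n}"

lemma partitions_ofD: "p \<in> partitions_of n \<Longrightarrow> is_partition p"
  by (simp add: partitions_of_def)

definition row_lengths :: "nat list \<Rightarrow> nat \<Rightarrow> nat" where
  "row_lengths xs i = (if i < length xs then xs ! i else 0)"

lemma diagram_row_lengths: "diagram (row_lengths xs) = young_diagram xs"
  by (auto simp: diagram_def row_lengths_def young_diagram_def split: if_splits)

lemma card_young_diagram: "card (young_diagram xs) = sum_list xs"
proof -
  have "young_diagram xs = (SIGMA i:{..<length xs}. {..<xs ! i})"
    by (auto simp: young_diagram_def)
  then show ?thesis by (simp add: sum_list_sum_nth atLeast0LessThan)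
qed

lemma fillings_young_diagram: "fillings (young_diagram xs) = standard_young_tableaux xs"
  by (simp add: fillings_def standard_young_tableaux_def card_young_diagram)

lemma bij_betw_row_lengths: "bij_betw row_lengths (partitions n) (partitions_of n)"
proof (rule bij_betwI')
  fix xs ys assume xs: "xs \<in> partitions n" and ys: "ys \<in> partitions n"
  \<comment> \<open>Positivity of the parts makes the length visible in the zero-padded function;
    trailing zeros would destroy injectivity.\<close>
  have len: "{i. row_lengths xs i \<noteq> 0} = {..<length xs}" if "xs \<in> partitions n" for xs
    using that by (force simp: row_lengths_def partitions_def)
  show "(row_lengths xs = row_lengths ys) = (xs = ys)"
  proof
    assume eq: "row_lengths xs = row_lengths ys"
    then have "length xs = length ys"
      using len[OF xs] len[OF ys] by (simp add: lessThan_eq_iff)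
    moreover from this have "xs ! i = ys ! i" if "i < length xs" for i
      using fun_cong[OF eq, of i] that by (simp add: row_lengths_def)
    ultimately show "xs = ys" by (rule nth_equalityI)
  qed simp
next
  fix xs assume xs: "xs \<in> partitions n"
  have "antimono (row_lengths xs)"
  proof (rule antimonoI)
    fix i j :: nat assume "i \<le> j"
    then show "row_lengths xs j \<le> row_lengths xs i"
      using xs by (cases "i = j") (auto simp: row_lengths_def partitions_def sorted_wrt_iff_nth_less)
  qed
  then show "row_lengths xs \<in> partitions_of n"
    using xs by (auto simp: partitions_of_def is_partition_def diagram_row_lengths
      finite_young_diagram card_young_diagram partitions_def)
next
  fix p assume p: "p \<in> partitions_of n"
  have mono: "p i' \<le> p i" if "i \<le> i'" for i i'
    using p that by (simp add: partitions_of_def is_partition_le)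
  have "finite {i. p i \<noteq> 0}"
    by (rule finite_subset[of _ "fst ` diagram p"])
      (use p in \<open>force simp: diagram_def partitions_of_def is_partition_def\<close>)+
  then obtain k where "\<forall>i\<in>{i. p i \<noteq> 0}. i < k"
    using finite_nat_set_iff_bounded by auto
  then have "p k = 0" by auto
  \<comment> \<open>The number of parts: by monotonicity every row after the first empty one is
    empty.\<close>
  define l where "l = (LEAST k. p k = 0)"
  have l: "p l = 0" unfolding l_def using \<open>p k = 0\<close> by (rule LeastI)
  have pos: "p i > 0" if "i < l" for i
    using not_less_Least[of i "\<lambda>k. p k = 0"] that by (simp add: l_def)
  let ?xs = "map p [0..<l]"
  have "row_lengths ?xs i = p i" for i
    using mono[of l i] l by (cases "i < l") (auto simp: row_lengths_def)
  then have row: "row_lengths ?xs = p" by blast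
  have "sum_list ?xs = n"
    using card_young_diagram[of ?xs] p unfolding diagram_row_lengths[symmetric] row
    by (simp add: partitions_of_def)
  moreover have "sorted_wrt (\<ge>) ?xs"
    by (auto simp: sorted_wrt_iff_nth_less intro: mono)
  ultimately have "?xs \<in> partitions n"
    using pos by (auto simp: partitions_def)
  with row show "\<exists>xs\<in>partitions n. p = row_lengths xs" by metis
qed

lemma finite_partitions_of: "finite (partitions_of n)"
  using bij_betw_row_lengths finite_partitions by (metis bij_betw_finite)

text \<open>Cutting off the largest entry turns pairs of a partition and a removable row into pairs
  of a smaller partition and an addable row. This moves \<open>sum_up\<close> onto \<open>K\<close>,
  which is why \<open>K\<close> must vary in the induction.\<close>

lemma sum_fillings_eq_funpow_sum_up:
  "(\<Sum>p\<in>partitions_of n. of_nat (card (fillings (diagram p))) * K p) = (sum_up ^^ n) K (\<lambda>_. 0)"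
proof (induction n arbitrary: K)
  case 0
  have "p = (\<lambda>_. 0)" if "p \<in> partitions_of 0" for p
  proof -
    have "diagram p = {}" using that by (auto simp: partitions_of_def is_partition_def)
    then show ?thesis by (auto simp: diagram_def fun_eq_iff)
  qed
  moreover have "(\<lambda>_. 0) \<in> partitions_of 0"
    by (simp add: partitions_of_def is_partition_empty) (simp add: diagram_def)
  ultimately have "partitions_of 0 = {\<lambda>_. 0}" by blast
  moreover have "fillings (diagram (\<lambda>_. 0)) = {\<lambda>_. undefined}"
    by (auto simp: diagram_def fillings_def bij_betw_def)
  ultimately show ?case by simp
next
  case (Suc n)
  let ?f = "\<lambda>p. of_nat (card (fillings (diagram p))) :: 'a"
  have "(\<Sum>p\<in>partitions_of (Suc n). ?f p * K p) =
      (\<Sum>p\<in>partitions_of (Suc n). \<Sum>i\<in>removable p. ?f (remove_cell p i) * K p)"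
  proof (rule sum.cong)
    fix p assume "p \<in> partitions_of (Suc n)"
    then have "is_partition p" "diagram p \<noteq> {}" by (auto simp: partitions_of_def)
    from card_fillings_diagram[OF this]
    show "?f p * K p = (\<Sum>i\<in>removable p. ?f (remove_cell p i) * K p)"
      by (simp add: sum_distrib_right)
  qed simp
  also have "\<dots> = (\<Sum>(p, i)\<in>(SIGMA p:partitions_of (Suc n). removable p). ?f (remove_cell p i) * K p)"
    by (rule sum.Sigma) (auto simp: finite_partitions_of intro!: finite_removable dest: partitions_ofD)
  also have "\<dots> = (\<Sum>(p, i)\<in>(SIGMA p:partitions_of n. addable p). ?f p * K (add_cell p i))"
  proof (rule sum.reindex_bij_witness[where i="\<lambda>(p, i). (add_cell p i, i)" and j="\<lambda>(p, i). (remove_cell p i, i)"])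
    fix x assume "x \<in> (SIGMA p:partitions_of (Suc n). removable p)"
    then obtain p i where x: "x = (p, i)" "is_partition p" "card (diagram p) = Suc n" "i \<in> removable p"
      unfolding partitions_of_def by blast
    have refill: "add_cell (remove_cell p i) i = p"
      using x by (auto simp: removable_def)
    then show "(case case x of (p, i) \<Rightarrow> (remove_cell p i, i) of (p, i) \<Rightarrow> (add_cell p i, i)) = x"
      by (simp add: x)
    have "(i, p i - 1) \<in> diagram p"
      using x by (auto simp: diagram_def removable_def)
    then have "card (diagram (remove_cell p i)) = n"
      using x unfolding diagram_remove_cell by (simp add: is_partition_def)
    then show "(case x of (p, i) \<Rightarrow> (remove_cell p i, i)) \<in> (SIGMA p:partitions_of n. addable p)"
      using is_partition_remove_cell[OF x(2,4)] addable_remove_cell[OF x(2,4)]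
      by (simp only: x partitions_of_def) simp
    show "(case case x of (p, i) \<Rightarrow> (remove_cell p i, i) of (p, i) \<Rightarrow> ?f p * K (add_cell p i)) =
        (case x of (p, i) \<Rightarrow> ?f (remove_cell p i) * K p)"
      using refill by (simp add: x)
  next
    fix x assume "x \<in> (SIGMA p:partitions_of n. addable p)"
    then obtain p i where x: "x = (p, i)" "is_partition p" "card (diagram p) = n" "i \<in> addable p"
      unfolding partitions_of_def by blast
    show "(case case x of (p, i) \<Rightarrow> (add_cell p i, i) of (p, i) \<Rightarrow> (remove_cell p i, i)) = x"
      by (simp add: x)
    have "card (diagram (add_cell p i)) = Suc n"
      using x by (subst diagram_add_cell, subst card_insert_disjoint) (auto simp: is_partition_def diagram_def)
    then show "(case x of (p, i) \<Rightarrow> (add_cell p i, i)) \<in> (SIGMA p:partitions_of (Suc n). removable p)"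
      using is_partition_add_cell[OF x(2,4)] removable_add_cell[OF x(2)]
      by (simp add: x partitions_of_def)
  qed
  also have "\<dots> = (\<Sum>p\<in>partitions_of n. \<Sum>i\<in>addable p. ?f p * K (add_cell p i))"
    by (rule sum.Sigma[symmetric]) (auto simp: finite_partitions_of intro!: finite_addable dest: partitions_ofD)
  also have "\<dots> = (\<Sum>p\<in>partitions_of n. ?f p * sum_up K p)"
    by (simp add: sum_up_def sum_distrib_left)
  also have "\<dots> = (sum_up ^^ Suc n) K (\<lambda>_. 0)"
    by (simp only: Suc.IH funpow_Suc_right o_apply)
  finally show ?case .
qed

section \<open>Hook products\<close>

definition hook :: "(nat \<times> nat) set \<Rightarrow> nat \<times> nat \<Rightarrow> nat" where
  "hook D = (\<lambda>(i, j). card {j'. j < j' \<and> (i, j') \<in> D} + card {i'. i < i' \<and> (i', j) \<in> D} + 1)"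

text \<open>The first-column hook lengths of a partition with at most \<open>L\<close> parts; they are
  only meaningful for indices below \<open>L\<close>.\<close>

definition beta :: "nat \<Rightarrow> (nat \<Rightarrow> nat) \<Rightarrow> nat \<Rightarrow> nat" where
  "beta L p i = p i + (L - Suc i)"

lemma beta_less:
  assumes "is_partition p" "i < k" "k < L"
  shows "beta L p k < beta L p i"
proof -
  have "p k \<le> p i" using assms by (simp add: is_partition_le)
  with assms show ?thesis by (simp add: beta_def)
qed

lemma beta_upd: "beta L (p(i := x)) = (beta L p)(i := x + (L - Suc i))"
  by (auto simp: beta_def fun_eq_iff)

lemma inj_on_beta: "is_partition p \<Longrightarrow> inj_on (beta L p) {..<L}"
  using beta_less by (intro linorder_inj_onI') (metis lessThan_iff less_irrefl)

text \<open>Part \<open>j\<close> of the conjugate partition, found as the first row too short to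
  meet column \<open>j\<close>.\<close>

definition column_length :: "(nat \<Rightarrow> nat) \<Rightarrow> nat \<Rightarrow> nat" where
  "column_length p j = (LEAST k. p k \<le> j)"

lemma less_column_length_iff:
  assumes p: "is_partition p" "p L = 0"
  shows "k < column_length p j \<longleftrightarrow> j < p k"
proof -
  have "p (column_length p j) \<le> j"
    unfolding column_length_def by (rule LeastI[of _ L]) (simp add: p)
  moreover have "p k \<le> p (column_length p j)" if "column_length p j \<le> k"
    using p that by (simp add: is_partition_le)
  moreover have "\<not> p k \<le> j" if "k < column_length p j"
    using that unfolding column_length_def by (rule not_less_Least)
  ultimately show ?thesis by force
qed

lemma hook_diagram:
  assumes p: "is_partition p" "p L = 0" and "j < p i"
  shows "hook (diagram p) (i, j) = (p i - Suc j) + (column_length p j - Suc i) + 1"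
proof -
  have "{j'. j < j' \<and> (i, j') \<in> diagram p} = {Suc j..<p i}"
    by (auto simp: diagram_def)
  moreover have "{i'. i < i' \<and> (i', j) \<in> diagram p} = {Suc i..<column_length p j}"
    by (auto simp: diagram_def less_column_length_iff[OF p])
  ultimately show ?thesis by (simp add: hook_def)
qed

text \<open>The hook lengths in row \<open>i\<close> and the differences to the later beta numbers
  together list \<open>{1..beta L p i}\<close> without repetition. Both families are injective, they
  are disjoint and lie in this range, and their sizes \<open>p i\<close> and
  \<open>L - Suc i\<close> add up to its size.\<close>

lemma prod_row_hooks:
  fixes g :: "nat \<Rightarrow> 'a::comm_monoid_mult"
  assumes p: "is_partition p" "p L = 0" and i: "i < L"
  shows "(\<Prod>j<p i. g (hook (diagram p) (i, j))) * (\<Prod>k\<in>{i<..<L}. g (beta L p i - beta L p k)) =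
    (\<Prod>h\<in>{1..beta L p i}. g h)"
proof -
  define h where "h j = (p i - Suc j) + (column_length p j - Suc i) + 1" for j
  define d where "d k = beta L p i - beta L p k" for k
  note col = less_column_length_iff[OF p]
  have mono: "p k' \<le> p k" if "k \<le> k'" for k k'
    using p that by (simp add: is_partition_le)
  have h_less: "h j' < h j" if "j < j'" "j' < p i" for j j'
  proof -
    have "column_length p j' \<le> column_length p j"
      using col[of _ j] col[of _ j'] that by (metis leI order.strict_trans less_irrefl)
    with that show ?thesis by (simp add: h_def)
  qed
  have inj_h: "inj_on h {..<p i}"
    using h_less by (intro linorder_inj_onI') (metis lessThan_iff less_irrefl)
  have d_less: "d k < d k'" if "k < k'" "k' < L" "i < k" for k k'
    using beta_less[OF p(1) that(1,2)] beta_less[OF p(1) that(3), of L] that by (simp add: d_def)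
  have inj_d: "inj_on d {i<..<L}"
    using d_less by (intro linorder_inj_onI') (metis greaterThanLessThan_iff less_irrefl)
  \<comment> \<open>The difference is \<open>p i - p k + k - i\<close>. If row \<open>k\<close>
    meets column \<open>j\<close>, the hook of \<open>(i, j)\<close> is longer than that; if not, it
    is shorter.\<close>
  have h_ne_d: "h j \<noteq> d k" if "j < p i" "i < k" "k < L" for j k
  proof -
    have "i < column_length p j" using col that by simp
    moreover have "p k \<le> p i" using mono that by simp
    ultimately show ?thesis
      using that col[of k j] by (cases "j < p k") (auto simp: h_def d_def beta_def)
  qed
  have disj: "h ` {..<p i} \<inter> d ` {i<..<L} = {}"
    using h_ne_d by auto
  have h_le: "h j \<in> {1..beta L p i}" if "j < p i" for j
  proof -
    have "column_length p j \<le> L" using col[of L j] p by simp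
    then show ?thesis using that by (auto simp: h_def beta_def)
  qed
  have d_le: "d k \<in> {1..beta L p i}" if "i < k" "k < L" for k
    using beta_less[OF p(1) that] by (auto simp: d_def)
  have "card (h ` {..<p i} \<union> d ` {i<..<L}) = card {1..beta L p i}"
    using disj i by (subst card_Un_disjoint) (auto simp: card_image inj_h inj_d beta_def)
  then have eq: "h ` {..<p i} \<union> d ` {i<..<L} = {1..beta L p i}"
    using h_le d_le by (intro card_subset_eq) auto
  have "(\<Prod>h\<in>{1..beta L p i}. g h) = (\<Prod>j<p i. g (h j)) * (\<Prod>k\<in>{i<..<L}. g (d k))"
    unfolding eq[symmetric] using disj
    by (simp add: prod.union_disjoint prod.reindex inj_h inj_d)
  moreover have "(\<Prod>j<p i. g (hook (diagram p) (i, j))) = (\<Prod>j<p i. g (h j))"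
    by (rule prod.cong) (auto simp: hook_diagram[OF p] h_def)
  ultimately show ?thesis by (simp add: d_def)
qed

lemma prod_diagram:
  fixes f :: "nat \<times> nat \<Rightarrow> 'a::comm_monoid_mult"
  assumes "is_partition p" "p L = 0"
  shows "(\<Prod>c\<in>diagram p. f c) = (\<Prod>i<L. \<Prod>j<p i. f (i, j))"
proof -
  have "p k = 0" if "L \<le> k" for k
    using assms that is_partition_le[of p L k] by simp
  then have "diagram p = (SIGMA i:{..<L}. {..<p i})"
    by (force simp: diagram_def not_le[symmetric])
  then show ?thesis by (simp add: prod.Sigma)
qed

text \<open>Changing one entry affects only the pairs containing it; an antisymmetric \<open>r\<close> contributes
  the same ratio no matter on which side the entry stands.\<close>

lemma prod_pairs_upd:
  fixes r :: "'b \<Rightarrow> 'b \<Rightarrow> 'a::field" and b :: "nat \<Rightarrow> 'b"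
  assumes anti: "\<And>x y. r x y = - r y x"
    and nz: "\<And>j k. j < k \<Longrightarrow> k < L \<Longrightarrow> r (b j) (b k) \<noteq> 0" and i: "i < L"
  shows "(\<Prod>j<L. \<Prod>k\<in>{j<..<L}. r ((b(i := x)) j) ((b(i := x)) k)) =
    (\<Prod>j<L. \<Prod>k\<in>{j<..<L}. r (b j) (b k)) * (\<Prod>k\<in>{..<L}-{i}. r x (b k) / r (b i) (b k))"
proof -
  let ?b = "b(i := x)"
  define c where "c = (\<lambda>(j, k). r (?b j) (?b k) / r (b j) (b k))"
  let ?P = "SIGMA j:{..<L}. {j<..<L}"
  let ?f = "\<lambda>k. (min i k, max i k)"
  have pairs: "(\<Prod>j<L. \<Prod>k\<in>{j<..<L}. F j k) = (\<Prod>(j, k)\<in>?P. F j k)" for F :: "nat \<Rightarrow> nat \<Rightarrow> 'a"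
    by (simp add: prod.Sigma)
  have flip: "r u x / r u y = r x u / r y u" for u y
    using anti[of u x] anti[of u y] by simp
  have "(\<Prod>(j, k)\<in>?P. r (?b j) (?b k)) = (\<Prod>(j, k)\<in>?P. r (b j) (b k)) * (\<Prod>z\<in>?P. c z)"
    unfolding prod.distrib[symmetric] using nz by (intro prod.cong) (auto simp: c_def)
  also have "(\<Prod>z\<in>?P. c z) = (\<Prod>z\<in>?f ` ({..<L} - {i}). c z)"
  proof (rule prod.mono_neutral_right)
    show "?f ` ({..<L} - {i}) \<subseteq> ?P" using i by (auto simp: min_def max_def)
    show "\<forall>z\<in>?P - ?f ` ({..<L} - {i}). c z = 1"
    proof
      fix z assume z: "z \<in> ?P - ?f ` ({..<L} - {i})"
      then obtain j k where jk: "z = (j, k)" "j < k" "k < L" by auto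
      have "j \<noteq> i"
      proof
        assume "j = i"
        then have "z = ?f k" "k \<in> {..<L} - {i}" using jk by auto
        with z show False by blast
      qed
      moreover have "k \<noteq> i"
      proof
        assume "k = i"
        then have "z = ?f j" "j \<in> {..<L} - {i}" using jk by auto
        with z show False by blast
      qed
      ultimately show "c z = 1" using jk nz by (simp add: c_def)
    qed
  qed simp
  also have "\<dots> = (\<Prod>k\<in>{..<L}-{i}. c (?f k))"
    by (subst prod.reindex) (auto simp: inj_on_def min_def max_def split: if_splits)
  also have "\<dots> = (\<Prod>k\<in>{..<L}-{i}. r x (b k) / r (b i) (b k))"
  proof (rule prod.cong)
    fix k assume "k \<in> {..<L} - {i}"
    then consider "k < i" | "i < k" by force
    then show "c (?f k) = r x (b k) / r (b i) (b k)"
      by cases (auto simp: c_def flip)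
  qed simp
  finally show ?thesis by (simp only: pairs)
qed

text \<open>The conditions keep all denominators nonzero and the powers of \<open>q\<close>
  distinct. The case \<open>k = 0\<close> of the first one excludes characteristic 2, as the
  interpolation identity requires.\<close>

locale generic_element =
  fixes q :: "'a::field"
  assumes one_plus_power_nonzero: "1 + q ^ k \<noteq> 0"
    and one_minus_power_nonzero: "0 < k \<Longrightarrow> 1 - q ^ k \<noteq> 0"
    and nonzero: "q \<noteq> 0"
begin

definition weight :: "nat \<Rightarrow> 'a" where
  "weight h = (1 + q ^ h) / (1 - q ^ h)"

definition hook_weight :: "(nat \<Rightarrow> nat) \<Rightarrow> 'a" where
  "hook_weight p = (\<Prod>c\<in>diagram p. weight (hook (diagram p) c))"

text \<open>This is the reciprocal of the weight of \<open>a - b\<close>, extended to an odd function of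
  the difference that vanishes at \<open>0\<close>.\<close>

definition inv_weight :: "nat \<Rightarrow> nat \<Rightarrow> 'a" where
  "inv_weight a b = (q ^ b - q ^ a) / (q ^ b + q ^ a)"

lemma power_add_nonzero: "q ^ a + q ^ b \<noteq> 0"
proof -
  have "q ^ a + q ^ b \<noteq> 0" if "a \<le> b" for a b
  proof -
    have "q ^ a + q ^ b = q ^ a * (1 + q ^ (b - a))"
      using that by (simp add: algebra_simps flip: power_add)
    then show ?thesis using nonzero one_plus_power_nonzero by simp
  qed
  from this[of a b] this[of b a] show ?thesis by (cases "a \<le> b") (auto simp: add.commute)
qed

lemma power_eq_iff: "q ^ a = q ^ b \<longleftrightarrow> a = b"
proof -
  have "q ^ a \<noteq> q ^ b" if "a < b" for a b
  proof -
    have "q ^ a - q ^ b = q ^ a * (1 - q ^ (b - a))"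
      using that by (simp add: algebra_simps flip: power_add)
    then show ?thesis using nonzero one_minus_power_nonzero[of "b - a"] that by auto
  qed
  then show ?thesis by (metis linorder_neqE_nat)
qed

lemma inv_weight_antisym: "inv_weight a b = - inv_weight b a"
proof -
  have "inv_weight a b = (- (q ^ a - q ^ b)) / (q ^ a + q ^ b)"
    by (simp add: inv_weight_def add.commute)
  then show ?thesis by (simp only: minus_divide_left inv_weight_def)
qed

lemma inv_weight_eq_0_iff: "inv_weight a b = 0 \<longleftrightarrow> a = b"
  by (auto simp: inv_weight_def power_add_nonzero power_eq_iff)

lemma inv_weight_Suc_Suc: "inv_weight (Suc a) (Suc b) = inv_weight a b"
  by (simp only: inv_weight_def power_Suc mult_divide_mult_cancel_left nonzero not_False_eq_True
    flip: right_diff_distrib distrib_left)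

lemma inv_weight_eq: "b < a \<Longrightarrow> inv_weight a b = 1 / weight (a - b)"
proof -
  assume "b < a"
  then have "q ^ a = q ^ b * q ^ (a - b)" by (simp flip: power_add)
  then have "inv_weight a b = (q ^ b * (1 - q ^ (a - b))) / (q ^ b * (1 + q ^ (a - b)))"
    by (simp add: inv_weight_def algebra_simps)
  then show ?thesis using nonzero by (simp add: weight_def)
qed

lemma weight_nonzero: "0 < h \<Longrightarrow> weight h \<noteq> 0"
  using one_minus_power_nonzero[of h] by (simp add: weight_def one_plus_power_nonzero)

text \<open>Analogue of the classical expression of the product of hook lengths as the product of
  all \<open>b_i!\<close> divided by that of the differences \<open>b_i - b_k\<close>, with every
  integer replaced by its weight.\<close>

definition beta_weight :: "nat \<Rightarrow> (nat \<Rightarrow> nat) \<Rightarrow> 'a" where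
  "beta_weight L b = (\<Prod>i<L. \<Prod>h\<in>{1..b i}. weight h) * (\<Prod>i<L. \<Prod>k\<in>{i<..<L}. inv_weight (b i) (b k))"

text \<open>Any \<open>L\<close> with \<open>p L = 0\<close> will do, so one \<open>L\<close> can
  serve a partition together with all its neighbours.\<close>

lemma hook_weight_eq_beta_weight:
  assumes p: "is_partition p" "p L = 0"
  shows "hook_weight p = beta_weight L (beta L p)"
proof -
  have "(\<Prod>j<p i. weight (hook (diagram p) (i, j))) =
      (\<Prod>h\<in>{1..beta L p i}. weight h) * (\<Prod>k\<in>{i<..<L}. inv_weight (beta L p i) (beta L p k))"
    if i: "i < L" for i
  proof -
    let ?w = "\<Prod>k\<in>{i<..<L}. weight (beta L p i - beta L p k)"
    have less: "beta L p k < beta L p i" if "k \<in> {i<..<L}" for k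
      using beta_less[OF p(1)] that by auto
    have w: "?w * (\<Prod>k\<in>{i<..<L}. inv_weight (beta L p i) (beta L p k)) = 1"
      unfolding prod.distrib[symmetric] using less
      by (intro prod.neutral) (simp add: inv_weight_eq weight_nonzero)
    show ?thesis
      unfolding prod_row_hooks[OF p i, of weight, symmetric] mult.assoc w by simp
  qed
  then show ?thesis
    by (simp add: hook_weight_def prod_diagram[OF p] beta_weight_def prod.distrib)
qed

lemma beta_weight_upd:
  assumes inj: "inj_on b {..<L}" and i: "i < L"
  shows "beta_weight L (b(i := x)) = beta_weight L b *
    ((\<Prod>h\<in>{1..x}. weight h) / (\<Prod>h\<in>{1..b i}. weight h) *
     (\<Prod>k\<in>{..<L}-{i}. inv_weight x (b k) / inv_weight (b i) (b k)))"
proof -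
  have 1: "(\<Prod>j<L. \<Prod>k\<in>{j<..<L}. inv_weight ((b(i := x)) j) ((b(i := x)) k)) =
      (\<Prod>j<L. \<Prod>k\<in>{j<..<L}. inv_weight (b j) (b k)) *
      (\<Prod>k\<in>{..<L}-{i}. inv_weight x (b k) / inv_weight (b i) (b k))"
  proof (rule prod_pairs_upd[OF inv_weight_antisym _ i])
    fix j k assume "j < k" "k < L"
    then show "inv_weight (b j) (b k) \<noteq> 0"
      using inj_onD[OF inj, of j k] by (auto simp: inv_weight_eq_0_iff)
  qed
  have 2: "(\<Prod>j<L. \<Prod>h\<in>{1..b j}. weight h) =
      (\<Prod>h\<in>{1..b i}. weight h) * (\<Prod>j\<in>{..<L}-{i}. \<Prod>h\<in>{1..b j}. weight h)"
    using i by (subst prod.remove[of _ i]) auto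
  have 3: "(\<Prod>j<L. \<Prod>h\<in>{1..(b(i := x)) j}. weight h) =
      (\<Prod>h\<in>{1..x}. weight h) * (\<Prod>j\<in>{..<L}-{i}. \<Prod>h\<in>{1..b j}. weight h)"
    using i by (subst prod.remove[of _ i]) auto
  have "(\<Prod>h\<in>{1..b i}. weight h) \<noteq> 0"
    by (simp add: weight_nonzero)
  then show ?thesis
    unfolding beta_weight_def 1 2 3 by (simp add: field_simps)
qed

text \<open>The two sums collect the residues at \<open>- q ^ (b i + 1)\<close> and at \<open>q ^ b i\<close>. The extra point
  \<open>-1\<close> contributes nothing since some \<open>b l\<close> is \<open>0\<close>.\<close>

lemma sum_beta_ratios:
  fixes b :: "nat \<Rightarrow> nat"
  assumes inj: "inj_on b {..<L}" and l: "l < L" "b l = 0"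
  shows "(\<Sum>i<L. weight (Suc (b i)) * (\<Prod>k\<in>{..<L}-{i}. inv_weight (Suc (b i)) (b k) / inv_weight (b i) (b k))) =
    weight 1 + (\<Sum>i<L. inv_weight (b i) 0 * (\<Prod>k\<in>{..<L}-{i}. inv_weight (b i) (Suc (b k)) / inv_weight (b i) (b k)))"
    (is "(\<Sum>i<L. ?u i) = _ + (\<Sum>i<L. ?d i)")
proof -
  let ?I = "{..<L}"
  define B where "B i = q ^ b i" for i
  define C where "C i = - (q ^ Suc (b i))" for i
  define S where "S = insert (- 1) (B ` ?I \<union> C ` ?I)"
  define \<phi> where "\<phi> z y = (y + z) / (y - z)" for y z :: 'a
  \<comment> \<open>The reciprocal of \<open>weight 1\<close>, contributed up to sign by the two
    points of the same row.\<close>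
  define r where "r = (1 - q) / (1 + q)"
  have q1: "1 + q \<noteq> 0" "1 - q \<noteq> 0"
    using one_plus_power_nonzero[of 1] one_minus_power_nonzero[of 1] by simp_all
  have r: "r \<noteq> 0" "r * weight 1 = 1"
    using q1 by (auto simp: r_def weight_def)
  have inj_B: "inj_on B ?I"
    using inj by (simp add: B_def inj_on_def power_eq_iff)
  have inj_C: "inj_on C ?I"
    using inj power_eq_iff[of "Suc _" "Suc _"] by (simp add: C_def inj_on_def nonzero)
  have BC: "B i \<noteq> C k" for i k
    using power_add_nonzero[of "b i" "Suc (b k)"] by (auto simp: B_def C_def)
  have B1: "B i \<noteq> - 1" for i
    using power_add_nonzero[of "b i" 0] by (auto simp: B_def)
  have C1: "C i \<noteq> - 1" for i
    using power_eq_iff[of "Suc (b i)" 0] by (simp add: C_def)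
  have card: "card S = Suc (2 * L)"
  proof -
    have "card (B ` ?I \<union> C ` ?I) = 2 * L"
      using BC by (subst card_Un_disjoint) (auto simp: card_image inj_B inj_C)
    moreover have "- 1 \<notin> B ` ?I \<union> C ` ?I"
      using B1 C1 by (metis UnE imageE)
    ultimately show ?thesis by (simp add: S_def)
  qed
  have "(\<Sum>z\<in>S. \<Prod>y\<in>S-{z}. \<phi> z y) = 1"
    unfolding \<phi>_def
  proof (rule sum_prod_sum_over_difference)
    show "0 \<notin> S" using nonzero by (auto simp: S_def B_def C_def)
    show "(2::'a) \<noteq> 0" using one_plus_power_nonzero[of 0] by simp
  qed (simp_all add: card, simp add: S_def)
  moreover have "(\<Sum>z\<in>S. \<Prod>y\<in>S-{z}. \<phi> z y) = (\<Prod>y\<in>S-{-1}. \<phi> (-1) y) +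
      ((\<Sum>i<L. \<Prod>y\<in>S-{B i}. \<phi> (B i) y) + (\<Sum>i<L. \<Prod>y\<in>S-{C i}. \<phi> (C i) y))"
  proof -
    have "(\<Sum>z\<in>S. F z) = F (-1) + ((\<Sum>i<L. F (B i)) + (\<Sum>i<L. F (C i)))" for F :: "'a \<Rightarrow> 'a"
    proof -
      have "(\<Sum>z\<in>S. F z) = F (-1) + (\<Sum>z\<in>B ` ?I \<union> C ` ?I. F z)"
        unfolding S_def using B1 C1 by (subst sum.insert) (auto, metis+)
      also have "(\<Sum>z\<in>B ` ?I \<union> C ` ?I. F z) = (\<Sum>i<L. F (B i)) + (\<Sum>i<L. F (C i))"
        using BC by (subst sum.union_disjoint) (auto simp: sum.reindex inj_B inj_C)
      finally show ?thesis .
    qed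
    then show ?thesis .
  qed
  moreover have "(\<Prod>y\<in>S-{-1}. \<phi> (-1) y) = 0"
  proof (rule prod_zero)
    have "B l = 1" by (simp add: B_def l)
    then show "\<exists>y\<in>S-{-1}. \<phi> (-1) y = 0"
      using l B1[of l] by (intro bexI[of _ "B l"]) (auto simp: S_def \<phi>_def)
  qed (simp add: S_def)
  moreover have "(\<Prod>y\<in>S-{B i}. \<phi> (B i) y) = - r * ?d i" if i: "i < L" for i
  proof -
    have S: "S - {B i} = insert (- 1) (B ` (?I - {i}) \<union> C ` ?I)"
      using B1[of i] BC[of i] inj_onD[OF inj_B, of i] i by (fastforce simp: S_def)
    have same: "\<phi> (B i) (B k) = 1 / inv_weight (b i) (b k)" for k
      by (simp add: \<phi>_def B_def inv_weight_def)
    have other: "\<phi> (B i) (C k) = inv_weight (b i) (Suc (b k))" for k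
    proof -
      have "\<phi> (B i) (C k) = (- (q ^ Suc (b k) - q ^ b i)) / (- (q ^ Suc (b k) + q ^ b i))"
        by (simp add: \<phi>_def B_def C_def)
      then show ?thesis by (simp only: minus_divide_divide inv_weight_def)
    qed
    have "(\<Prod>y\<in>S-{B i}. \<phi> (B i) y) = \<phi> (B i) (-1) * (\<Prod>y\<in>B ` (?I - {i}) \<union> C ` ?I. \<phi> (B i) y)"
      unfolding S using B1 C1 by (subst prod.insert) (auto, metis+)
    also have "(\<Prod>y\<in>B ` (?I - {i}) \<union> C ` ?I. \<phi> (B i) y) =
        (\<Prod>k\<in>?I-{i}. \<phi> (B i) (B k)) * (\<Prod>k\<in>?I. \<phi> (B i) (C k))"
      using BC inj_on_subset[OF inj_B, of "?I - {i}"]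
      by (subst prod.union_disjoint) (auto simp: prod.reindex inj_C)
    also have "(\<Prod>k\<in>?I. \<phi> (B i) (C k)) = \<phi> (B i) (C i) * (\<Prod>k\<in>?I-{i}. \<phi> (B i) (C k))"
      using i by (subst prod.remove[of _ i]) auto
    \<comment> \<open>At \<open>C i\<close> the corresponding factor is \<open>r\<close>; this
      opposite sign is what puts the two sums on different sides of the identity.\<close>
    also have "\<phi> (B i) (C i) = - r"
    proof -
      have "\<phi> (B i) (C i) = (q ^ b i * (1 - q)) / (- (q ^ b i * (1 + q)))"
        by (simp add: \<phi>_def B_def C_def algebra_simps)
      also have "\<dots> = - ((q ^ b i * (1 - q)) / (q ^ b i * (1 + q)))"
        by (rule divide_minus_right)
      finally show ?thesis using nonzero by (simp add: r_def)
    qed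
    also have "\<phi> (B i) (-1) = inv_weight (b i) 0"
    proof -
      have "\<phi> (B i) (-1) = (- (1 - B i)) / (- (1 + B i))"
        by (simp add: \<phi>_def)
      then show ?thesis by (simp only: minus_divide_divide inv_weight_def B_def power_0)
    qed
    finally show ?thesis by (simp add: same other prod_dividef)
  qed
  moreover have "(\<Prod>y\<in>S-{C i}. \<phi> (C i) y) = r * ?u i" if i: "i < L" for i
  proof -
    have S: "S - {C i} = insert (- 1) (B ` ?I \<union> C ` (?I - {i}))"
      using C1[of i] BC[of _ i] inj_onD[OF inj_C, of i] i by (fastforce simp: S_def)
    have same: "\<phi> (C i) (C k) = 1 / inv_weight (b i) (b k)" for k
    proof -
      have "\<phi> (C i) (C k) = (- q * (q ^ b k + q ^ b i)) / (- q * (q ^ b k - q ^ b i))"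
        by (simp add: \<phi>_def C_def algebra_simps)
      also have "\<dots> = (q ^ b k + q ^ b i) / (q ^ b k - q ^ b i)"
        using nonzero by (intro mult_divide_mult_cancel_left) simp
      finally show ?thesis by (simp add: inv_weight_def)
    qed
    have other: "\<phi> (C i) (B k) = inv_weight (Suc (b i)) (b k)" for k
      by (simp add: \<phi>_def B_def C_def inv_weight_def)
    have "(\<Prod>y\<in>S-{C i}. \<phi> (C i) y) = \<phi> (C i) (-1) * (\<Prod>y\<in>B ` ?I \<union> C ` (?I - {i}). \<phi> (C i) y)"
      unfolding S using B1 C1 by (subst prod.insert) (auto, metis+)
    also have "(\<Prod>y\<in>B ` ?I \<union> C ` (?I - {i}). \<phi> (C i) y) =
        (\<Prod>k\<in>?I. \<phi> (C i) (B k)) * (\<Prod>k\<in>?I-{i}. \<phi> (C i) (C k))"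
      using BC inj_on_subset[OF inj_C, of "?I - {i}"]
      by (subst prod.union_disjoint) (auto simp: prod.reindex inj_B)
    also have "(\<Prod>k\<in>?I. \<phi> (C i) (B k)) = \<phi> (C i) (B i) * (\<Prod>k\<in>?I-{i}. \<phi> (C i) (B k))"
      using i by (subst prod.remove[of _ i]) auto
    also have "\<phi> (C i) (B i) = r"
    proof -
      have "\<phi> (C i) (B i) = (q ^ b i * (1 - q)) / (q ^ b i * (1 + q))"
        by (simp add: \<phi>_def B_def C_def algebra_simps)
      then show ?thesis using nonzero by (simp add: r_def)
    qed
    also have "\<phi> (C i) (-1) = weight (Suc (b i))"
    proof -
      have "\<phi> (C i) (-1) = (- (1 + q ^ Suc (b i))) / (- (1 - q ^ Suc (b i)))"
        by (simp add: \<phi>_def C_def)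
      then show ?thesis by (simp only: minus_divide_divide weight_def)
    qed
    finally show ?thesis by (simp add: same other prod_dividef)
  qed
  ultimately have "r * (\<Sum>i<L. ?u i) - r * (\<Sum>i<L. ?d i) = 1"
    by (simp add: sum_distrib_left sum_negf)
  then have "r * (\<Sum>i<L. ?u i) = r * (weight 1 + (\<Sum>i<L. ?d i))"
    using r by (simp add: algebra_simps)
  with r show ?thesis by (simp only: mult_cancel_left) simp
qed

text \<open>Each neighbour of \<open>p\<close> has weight \<open>hook_weight p\<close> times a ratio
  in the beta numbers. The ratios vanish for rows that cannot change, so both sums extend to all
  rows below \<open>L\<close>, where \<open>sum_beta_ratios\<close> applies.\<close>

lemma sum_up_hook_weight:
  assumes p: "is_partition p"
  shows "sum_up hook_weight p = weight 1 * hook_weight p + sum_down hook_weight p"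
proof -
  have "finite (fst ` diagram p)" using p by (simp add: is_partition_def)
  then obtain l where l: "\<And>i. i \<in> fst ` diagram p \<Longrightarrow> i < l"
    using finite_nat_set_iff_bounded by auto
  have p0: "p k = 0" if "l \<le> k" for k
    using l[of k] that by (force simp: diagram_def)
  \<comment> \<open>Row \<open>l\<close> is empty and is the last one counted: its beta number is
    the 0 that \<open>sum_beta_ratios\<close> asks for, and it leaves room for a new row.\<close>
  define L where "L = Suc l"
  define b where "b = beta L p"
  have inj: "inj_on b {..<L}" using inj_on_beta[OF p] by (simp add: b_def)
  have hw: "hook_weight p = beta_weight L b"
    unfolding b_def by (rule hook_weight_eq_beta_weight[OF p]) (simp add: p0 L_def)
  define u where "u i = weight (Suc (b i)) *
    (\<Prod>k\<in>{..<L}-{i}. inv_weight (Suc (b i)) (b k) / inv_weight (b i) (b k))" for i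
  define d where "d i = inv_weight (b i) 0 *
    (\<Prod>k\<in>{..<L}-{i}. inv_weight (b i) (Suc (b k)) / inv_weight (b i) (b k))" for i
  have add_L: "i < L" if "i \<in> addable p" for i
  proof (rule ccontr)
    assume "\<not> i < L"
    then have "p (i - 1) = 0" "i \<noteq> 0" by (auto simp: L_def intro: p0)
    with that show False by (simp add: addable_def)
  qed
  have rem_l: "i < l" if "i \<in> removable p" for i
    using that p0[of i] by (cases "i < l") (auto simp: removable_def)
  have "sum_up hook_weight p = (\<Sum>i\<in>addable p. hook_weight p * u i)"
    unfolding sum_up_def
  proof (rule sum.cong)
    fix i assume i: "i \<in> addable p"
    have iL: "i < L" using add_L[OF i] .
    have "hook_weight (add_cell p i) = beta_weight L (b(i := Suc (b i)))"
      using hook_weight_eq_beta_weight[OF is_partition_add_cell[OF p i], of L] iL p0[of L]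
      unfolding beta_upd b_def by (simp add: L_def beta_def)
    also have "\<dots> = hook_weight p * u i"
      unfolding beta_weight_upd[OF inj iL] hw u_def
      using weight_nonzero by simp
    finally show "hook_weight (add_cell p i) = hook_weight p * u i" .
  qed simp
  also have "\<dots> = (\<Sum>i<L. hook_weight p * u i)"
  proof (rule sum.mono_neutral_left)
    show "\<forall>i\<in>{..<L} - addable p. hook_weight p * u i = 0"
    proof
      fix i assume i: "i \<in> {..<L} - addable p"
      then obtain k where k: "i = Suc k" "p k \<le> p i" by (cases i) (auto simp: addable_def)
      moreover have "p i \<le> p k" using p k by (simp add: is_partition_le)
      \<comment> \<open>Equal row lengths mean consecutive beta numbers, so raising
        \<open>b i\<close> makes it collide with the one above.\<close>
      ultimately have "b k = Suc (b i)" using i by (auto simp: b_def beta_def L_def)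
      then have "inv_weight (Suc (b i)) (b k) = 0" by (simp add: inv_weight_eq_0_iff)
      then have "(\<Prod>k\<in>{..<L}-{i}. inv_weight (Suc (b i)) (b k) / inv_weight (b i) (b k)) = 0"
        using i k by (intro prod_zero bexI[of _ k]) auto
      then show "hook_weight p * u i = 0" by (simp add: u_def)
    qed
  qed (use add_L in auto)
  also have "\<dots> = hook_weight p * (weight 1 + (\<Sum>i<L. d i))"
    using sum_beta_ratios[OF inj, of l] p0[of l]
    by (simp add: u_def d_def L_def b_def beta_def flip: sum_distrib_left)
  also have "\<dots> = weight 1 * hook_weight p + (\<Sum>i<L. hook_weight p * d i)"
    by (simp add: algebra_simps sum_distrib_left)
  also have "(\<Sum>i<L. hook_weight p * d i) = (\<Sum>i\<in>removable p. hook_weight p * d i)"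
  proof (rule sum.mono_neutral_right)
    show "\<forall>i\<in>{..<L} - removable p. hook_weight p * d i = 0"
    proof
      fix i assume i: "i \<in> {..<L} - removable p"
      show "hook_weight p * d i = 0"
      \<comment> \<open>Row \<open>l\<close> has no later row below \<open>L\<close> to collide
        with; its term is killed by the factor \<open>inv_weight 0 0\<close> instead.\<close>
      proof (cases "i = l")
        case True
        then have "b i = 0" using p0[of l] by (simp add: b_def beta_def L_def)
        then show ?thesis by (simp add: d_def inv_weight_eq_0_iff)
      next
        case False
        have "p i \<le> p (Suc i)" using i by (simp add: removable_def)
        moreover have "p (Suc i) \<le> p i" using p by (simp add: is_partition_le)
        ultimately have "b i = Suc (b (Suc i))" using i False by (auto simp: b_def beta_def L_def)
        then have "inv_weight (b i) (Suc (b (Suc i))) = 0" by (simp add: inv_weight_eq_0_iff)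
        then have "(\<Prod>k\<in>{..<L}-{i}. inv_weight (b i) (Suc (b k)) / inv_weight (b i) (b k)) = 0"
          using i False by (intro prod_zero bexI[of _ "Suc i"]) (auto simp: L_def)
        then show ?thesis by (simp add: d_def)
      qed
    qed
  qed (use rem_l in \<open>auto simp: L_def less_SucI\<close>)
  also have "\<dots> = sum_down hook_weight p"
    unfolding sum_down_def
  proof (rule sum.cong)
    fix i assume i: "i \<in> removable p"
    have iL: "i < L" using rem_l[OF i] by (simp add: L_def)
    have pi: "0 < p i" using i by (simp add: removable_def)
    then obtain m where m: "b i = Suc m" by (metis add_gr_0 b_def beta_def gr0_implies_Suc)
    have "beta L (remove_cell p i) = b(i := m)"
      using m pi unfolding beta_upd b_def by (simp add: beta_def)
    then have "hook_weight (remove_cell p i) = beta_weight L (b(i := m))"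
      using hook_weight_eq_beta_weight[OF is_partition_remove_cell[OF p i], of L] iL p0[of L]
      by (simp add: L_def)
    also have "\<dots> = hook_weight p * d i"
    proof -
      have "inv_weight (b i) 0 = 1 / weight (Suc m)"
        using inv_weight_eq[of 0 "b i"] m by simp
      \<comment> \<open>Removal lowers the entry \<open>b i\<close>, whereas \<open>d\<close> raises
        the others; \<open>inv_weight\<close> depends only on the difference, so the numerators
        agree.\<close>
      moreover have "inv_weight (b i) (Suc (b k)) = inv_weight m (b k)" for k
        by (simp add: m inv_weight_Suc_Suc)
      ultimately show ?thesis
        unfolding beta_weight_upd[OF inj iL] hw d_def
        using weight_nonzero by (simp add: m)
    qed
    finally show "hook_weight p * d i = hook_weight (remove_cell p i)" by simp
  qed simp
  finally show ?thesis .
qed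

lemma sum_num_syt_hook_weight:
  "(\<Sum>xs \<in> partitions n. of_nat (num_syt xs) *
     (\<Prod>c \<in> young_diagram xs. weight (hook_length xs c))) = involution_poly (weight 1) n"
proof -
  have hook: "hook_length xs = hook (young_diagram xs)" for xs
    by (simp add: hook_length_def hook_def)
  have "(\<Sum>xs \<in> partitions n. of_nat (num_syt xs) *
      (\<Prod>c \<in> young_diagram xs. weight (hook_length xs c))) =
    (\<Sum>p \<in> partitions_of n. of_nat (card (fillings (diagram p))) * hook_weight p)"
    by (subst sum.reindex_bij_betw[OF bij_betw_row_lengths, symmetric])
      (simp add: hook_weight_def diagram_row_lengths fillings_young_diagram num_syt_def hook)
  also have "\<dots> = (sum_up ^^ n) hook_weight (\<lambda>_. 0)"
    by (rule sum_fillings_eq_funpow_sum_up)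
  also have "\<dots> = involution_poly (weight 1) n"
    by (rule funpow_sum_up_eq_involution_poly[OF sum_up_hook_weight])
      (simp_all add: hook_weight_def diagram_def)
  finally show ?thesis .
qed

end

section \<open>Specialisation to rational functions\<close>

interpretation ratfun: generic_element ratfun_var
proof
  show "ratfun_var \<noteq> 0"
    by (simp add: ratfun_var_def Zero_fract_def eq_fract)
  show "1 - ratfun_var ^ k \<noteq> 0" if "0 < k" for k
    using one_minus_ratfun_var_power_nonzero that .
  show "1 + ratfun_var ^ k \<noteq> 0" for k
  proof (cases "k = 0")
    case True
    then show ?thesis by (simp add: One_fract_def Zero_fract_def eq_fract)
  next
    case False
    \<comment> \<open>A difference of squares reduces the claim to the nonvanishing already known
      for the minus sign.\<close>
    then have "1 - ratfun_var ^ (2 * k) \<noteq> 0"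
      by (intro one_minus_ratfun_var_power_nonzero) simp
    moreover have "1 - ratfun_var ^ (2 * k) = (1 + ratfun_var ^ k) * (1 - ratfun_var ^ k)"
      by (simp only: mult_2 power_add) (simp add: algebra_simps)
    ultimately show ?thesis by auto
  qed
qed

theorem theorem1:
  fixes n :: nat
  shows "(\<Sum>p \<in> involutions n. ((1 + ratfun_var) / (1 - ratfun_var)) ^ num_fixed_points n p) =
         (\<Sum>xs \<in> partitions n. of_nat (num_syt xs) *
            (\<Prod>c \<in> young_diagram xs.
               (1 + ratfun_var ^ hook_length xs c) / (1 - ratfun_var ^ hook_length xs c)))"
  using ratfun.sum_num_syt_hook_weight[of n]
  unfolding sum_involutions ratfun.weight_def power_one_right by (rule sym)

end
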